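(* Let $G$ be a connected $(P_7, C_4, \text{kite})$-free graph with $\delta(G)\ge \omega(G)+1$. If $G$ has no clique cutset, then there is an integer $\ell\ge 0$ such that $G=K_\ell+H$, where $H$ is the Petersen graph or $F$.
   Context: All graphs are finite and simple. $P_t$ and $C_t$ denote the path and cycle on $t$ vertices; $G$ is $H$-free if it has no induced subgraph isomorphic to $H$. A diamond is the graph obtained from two triangles sharing exactly one edge. A kite is the graph consisting of a diamond together with one further vertex adjacent to exactly one of the two degree-2 vertices of the diamond. A clique cutset of $G$ is a clique $K$ such that $G-K$ has more connected components than $G$. $\delta(G)$ is the minimum degree, $\omega(G)$ the clique number. For graphs $G_1,G_2$, $G_1+G_2$ denotes the join: vertex set $V(G_1)\cup V(G_2)$ (disjoint), edge set $E(G_1)\cup E(G_2)\cup\{uv: u\in V(G_1), v\in V(G_2)\}$; $K_0$ is the empty graph. The graph $F$ is obtained from a $7$-hole $v_1v_2\cdots v_7v_1$ by adding a stable set $\{y_1,y_2,y_3\}$ with $N(y_1)=\{v_1,v_4,v_5\}$, $N(y_2)=\{v_2,v_5,v_6\}$, $N(y_3)=\{v_3,v_6,v_7\}$ and no other edges. *)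

theory Defs
  imports Main
begin

definition graph :: "'a set \<Rightarrow> ('a \<times> 'a) set \<Rightarrow> bool" where
  "graph V E \<longleftrightarrow> finite V \<and> E \<subseteq> V \<times> V \<and> sym E \<and> (\<forall>x. (x, x) \<notin> E)"

definition symc :: "('a \<times> 'a) set \<Rightarrow> ('a \<times> 'a) set" where
  "symc S = S \<union> S\<inverse>"

definition contains_induced ::
  "'a set \<Rightarrow> ('a \<times> 'a) set \<Rightarrow> 'b set \<Rightarrow> ('b \<times> 'b) set \<Rightarrow> bool" where
  "contains_induced V E W F \<longleftrightarrow>
     (\<exists>f. inj_on f W \<and> f ` W \<subseteq> V \<and>
          (\<forall>x\<in>W. \<forall>y\<in>W. (f x, f y) \<in> E \<longleftrightarrow> (x, y) \<in> F))"

definition H_free ::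
  "'a set \<Rightarrow> ('a \<times> 'a) set \<Rightarrow> 'b set \<Rightarrow> ('b \<times> 'b) set \<Rightarrow> bool" where
  "H_free V E W F \<longleftrightarrow> \<not> contains_induced V E W F"

definition graph_iso ::
  "'a set \<Rightarrow> ('a \<times> 'a) set \<Rightarrow> 'b set \<Rightarrow> ('b \<times> 'b) set \<Rightarrow> bool" where
  "graph_iso V E W F \<longleftrightarrow>
     (\<exists>f. bij_betw f V W \<and> (\<forall>x\<in>V. \<forall>y\<in>V. (x, y) \<in> E \<longleftrightarrow> (f x, f y) \<in> F))"

definition path_V :: "nat \<Rightarrow> nat set" where "path_V t = {0..<t}"
definition path_E :: "nat \<Rightarrow> (nat \<times> nat) set" where
  "path_E t = symc {(i, i + 1) | i. i + 1 < t}"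

definition cycle_V :: "nat \<Rightarrow> nat set" where "cycle_V t = {0..<t}"
definition cycle_E :: "nat \<Rightarrow> (nat \<times> nat) set" where
  "cycle_E t = symc {(i, (i + 1) mod t) | i. i < t}"

text \<open>Kite: diamond on 0,1,2,3 (triangles 012 and 123 sharing edge 12; the degree-2
vertices are 0 and 3) plus vertex 4 adjacent only to 0.\<close>
definition kite_V :: "nat set" where "kite_V = {0..<5}"
definition kite_E :: "(nat \<times> nat) set" where
  "kite_E = symc {(0,1), (0,2), (1,2), (1,3), (2,3), (0,4)}"

text \<open>Petersen graph: outer 5-cycle 0..4, spokes i -- i+5, inner pentagram.\<close>
definition petersen_V :: "nat set" where "petersen_V = {0..<10}"
definition petersen_E :: "(nat \<times> nat) set" where
  "petersen_E = symc ({(i, (i + 1) mod 5) | i. i < 5} \<union> {(i, i + 5) | i. i < 5}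
                      \<union> {(i + 5, (i + 2) mod 5 + 5) | i. i < 5})"

text \<open>F: 7-hole v1..v7 = 0..6, y1,y2,y3 = 7,8,9 with N(y1)={v1,v4,v5},
N(y2)={v2,v5,v6}, N(y3)={v3,v6,v7}.\<close>
definition F_V :: "nat set" where "F_V = {0..<10}"
definition F_E :: "(nat \<times> nat) set" where
  "F_E = symc ({(i, (i + 1) mod 7) | i. i < 7} \<union>
               {(7,0), (7,3), (7,4), (8,1), (8,4), (8,5), (9,2), (9,5), (9,6)})"

definition join_K_V :: "nat \<Rightarrow> 'b set \<Rightarrow> (nat + 'b) set" where
  "join_K_V l W = Inl ` {0..<l} \<union> Inr ` W"
definition join_K_E :: "nat \<Rightarrow> 'b set \<Rightarrow> ('b \<times> 'b) set \<Rightarrow> ((nat + 'b) \<times> (nat + 'b)) set" where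
  "join_K_E l W F =
     {(Inl i, Inl j) | i j. i < l \<and> j < l \<and> i \<noteq> j}
     \<union> {(Inr x, Inr y) | x y. (x, y) \<in> F}
     \<union> symc {(Inl i, Inr x) | i x. i < l \<and> x \<in> W}"

definition components :: "'a set \<Rightarrow> ('a \<times> 'a) set \<Rightarrow> 'a set set" where
  "components V E = {{y \<in> V. (x, y) \<in> (E \<inter> V \<times> V)\<^sup>*} | x. x \<in> V}"

definition connected_graph :: "'a set \<Rightarrow> ('a \<times> 'a) set \<Rightarrow> bool" where
  "connected_graph V E \<longleftrightarrow> card (components V E) = 1"

definition is_clique :: "'a set \<Rightarrow> ('a \<times> 'a) set \<Rightarrow> 'a set \<Rightarrow> bool" where
  "is_clique V E K \<longleftrightarrow> K \<subseteq> V \<and> (\<forall>x\<in>K. \<forall>y\<in>K. x \<noteq> y \<longrightarrow> (x, y) \<in> E)"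

definition is_clique_cutset :: "'a set \<Rightarrow> ('a \<times> 'a) set \<Rightarrow> 'a set \<Rightarrow> bool" where
  "is_clique_cutset V E K \<longleftrightarrow> is_clique V E K \<and>
     card (components (V - K) (E \<inter> (V - K) \<times> (V - K))) > card (components V E)"

definition degree :: "'a set \<Rightarrow> ('a \<times> 'a) set \<Rightarrow> 'a \<Rightarrow> nat" where
  "degree V E x = card {y \<in> V. (x, y) \<in> E}"

definition min_degree :: "'a set \<Rightarrow> ('a \<times> 'a) set \<Rightarrow> nat" where
  "min_degree V E = Min (degree V E ` V)"

definition clique_number :: "'a set \<Rightarrow> ('a \<times> 'a) set \<Rightarrow> nat" where
  "clique_number V E = Max (card ` {K. is_clique V E K})"

end

(* Let a, d be nonadjacent with a maximal common neighbourhood Q, and suppose that Q has at least two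
   elements. As G is C4-free, Q is a clique, hence no cutset; walking from a through G - Q, kite-freeness
   shows that every other vertex is adjacent to all but at most one vertex of Q. By maximality of Q all
   these vertices miss the same element of Q, so another element of Q is universal. Hence removing all
   universal vertices, which form a clique, leaves a graph in which nonadjacent vertices have at most one
   common neighbour, and the remaining hypotheses survive. In such a graph an edge vu together with the
   common neighbours of v and u is a clique, so the degree bound gives v at least two neighbours outside
   the closed neighbourhood of u. This local condition forces so many vertices that a short exhaustive
   search finishes the proof: an induced P6 always extends to an induced P7, and without induced P6
   every edge extends to the Petersen graph, to which no further vertex can be attached.
   The graph F never occurs, since its minimum degree and clique number are both 3. *)
theory Submission
  imports Defs
begin

section \<open>Diamonds and universal vertices\<close>

lemma rtrancl_exit:
  assumes "(x, y) \<in> R\<^sup>*" "x \<in> S" "y \<notin> S"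
  obtains p q where "(p, q) \<in> R" "p \<in> S" "q \<notin> S"
  using assms by (induction rule: rtrancl_induct) auto

text \<open>In \<open>kite\<close> the diamond has far ends \<open>a\<close> and \<open>d\<close>,
  and \<open>e\<close> hangs on \<open>a\<close>. \<open>no_cutset\<close> at the empty clique also
  yields connectedness.\<close>

locale C4_kite_free =
  fixes V :: "'a set" and E :: "('a \<times> 'a) set"
  assumes graph: "graph V E"
    and C4: "\<lbrakk>(a, b) \<in> E; (b, c) \<in> E; (c, d) \<in> E; (d, a) \<in> E; a \<noteq> c; b \<noteq> d\<rbrakk>
      \<Longrightarrow> (a, c) \<in> E \<or> (b, d) \<in> E"
    and kite: "\<lbrakk>(a, b) \<in> E; (a, c) \<in> E; (b, c) \<in> E; (b, d) \<in> E; (c, d) \<in> E; (a, d) \<notin> E; a \<noteq> d;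
        (a, e) \<in> E; e \<noteq> b; e \<noteq> c\<rbrakk> \<Longrightarrow> (e, b) \<in> E \<or> (e, c) \<in> E \<or> (e, d) \<in> E"
    and no_cutset: "\<lbrakk>is_clique V E K; x \<in> V - K; y \<in> V - K\<rbrakk>
      \<Longrightarrow> (x, y) \<in> (E \<inter> (V - K) \<times> (V - K))\<^sup>*"
begin

abbreviation nbr (infix "\<sim>" 50) where "x \<sim> y \<equiv> (x, y) \<in> E"

lemma sym: "x \<sim> y \<Longrightarrow> y \<sim> x"
  using graph by (auto simp: graph_def dest: symD)

lemma irrefl: "\<not> x \<sim> x"
  using graph by (auto simp: graph_def)

lemma in_V: "x \<sim> y \<Longrightarrow> x \<in> V" "x \<sim> y \<Longrightarrow> y \<in> V"
  using graph by (auto simp: graph_def)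

definition common :: "'a \<Rightarrow> 'a \<Rightarrow> 'a set" where
  "common x y = {z. x \<sim> z \<and> y \<sim> z}"

lemma finite_common [simp]: "finite (common x y)"
  using graph by (auto simp: graph_def common_def intro: finite_subset[of _ V])

end

section \<open>A nonadjacent pair with a largest common neighbourhood\<close>

locale max_common_nbrs = C4_kite_free +
  fixes a d :: 'a
  assumes nonadj: "\<not> a \<sim> d" "a \<noteq> d" and two: "2 \<le> card (common a d)"
    and max: "\<lbrakk>\<not> x \<sim> y; x \<noteq> y; 2 \<le> card (common x y)\<rbrakk> \<Longrightarrow> card (common x y) \<le> card (common a d)"
begin

abbreviation "Q \<equiv> common a d"

lemma Q_clique: "\<lbrakk>p \<in> Q; q \<in> Q; p \<noteq> q\<rbrakk> \<Longrightarrow> p \<sim> q"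
  using C4[of a p d q] nonadj sym unfolding common_def by blast

lemma another_in_Q: obtains b where "b \<in> Q" "b \<noteq> c"
proof -
  have "\<not> Q \<subseteq> {c}"
    using two card_mono[of "{c}" Q] by auto
  then show thesis using that by auto
qed

definition full :: "'a \<Rightarrow> bool" where
  "full z \<longleftrightarrow> z \<in> V - Q \<and> (\<forall>q\<in>Q. z \<sim> q)"

definition misses :: "'a \<Rightarrow> 'a \<Rightarrow> bool" where
  "misses z c \<longleftrightarrow> z \<in> V - Q \<and> c \<in> Q \<and> \<not> z \<sim> c \<and> (\<forall>q\<in>Q - {c}. z \<sim> q)"

lemma full_ends: "full a" "full d"
  using another_in_Q irrefl in_V unfolding full_def common_def by blast+

lemma not_full_and_misses: "full z \<Longrightarrow> \<not> misses z c"
  unfolding full_def misses_def by auto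

text \<open>An edge \<open>x y\<close> would close the 4-cycle \<open>x\<close>, \<open>b\<close>,
  \<open>c\<close>, \<open>y\<close>, whose diagonals \<open>x c\<close> and \<open>b y\<close> are
  both absent.\<close>

lemma misses_nonadj:
  assumes "misses x c" "misses y b" "b \<noteq> c"
  shows "\<not> x \<sim> y"
  using assms C4[of x b c y] Q_clique sym unfolding misses_def by blast

text \<open>\<open>w\<close> lies outside \<open>Q\<close>, so it is not adjacent to both
  \<open>a\<close> and \<open>d\<close>; one of these two serves as \<open>e\<close>.\<close>

lemma full_nonadj_end:
  assumes "full w"
  obtains e where "full e" "\<not> w \<sim> e" "w \<noteq> e"
proof (cases "w = a \<or> w = d")
  case True
  then show thesis using that full_ends nonadj sym by metis
next
  case False
  have "\<not> (w \<sim> a \<and> w \<sim> d)" using assms sym unfolding full_def common_def by auto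
  then show thesis using that full_ends False by metis
qed

lemma at_most_one_missed:
  assumes z: "z \<in> V - Q"
    and nb: "\<And>b c. \<lbrakk>b \<in> Q; c \<in> Q; b \<noteq> c\<rbrakk> \<Longrightarrow> z \<sim> b \<or> z \<sim> c"
  shows "full z \<or> (\<exists>c. misses z c)"
  using assms unfolding full_def misses_def by blast

abbreviation "R \<equiv> E \<inter> (V - Q) \<times> (V - Q)"

text \<open>That every vertex outside \<open>Q\<close> is adjacent to all but at most one vertex of \<open>Q\<close> is not
preserved along arbitrary edges: the step to a neighbour uses two predecessors on a shortest path
from \<open>a\<close>, hence the induction on the distance from \<open>a\<close> in \<open>G - Q\<close>.\<close>

definition at_dist :: "nat \<Rightarrow> 'a \<Rightarrow> bool" where
  "at_dist n z \<longleftrightarrow> (a, z) \<in> R ^^ n \<and> (\<forall>m<n. (a, z) \<notin> R ^^ m)"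

lemma at_dist_pred:
  assumes "at_dist (Suc n) z"
  obtains w where "at_dist n w" "(w, z) \<in> R"
proof -
  obtain w where w: "(a, w) \<in> R ^^ n" "(w, z) \<in> R"
    using assms unfolding at_dist_def by auto
  have "(a, w) \<notin> R ^^ m" if "m < n" for m
    using that w(2) assms relpow_Suc_I[of a w m R z] unfolding at_dist_def by auto
  then show thesis using w that unfolding at_dist_def by blast
qed

lemma at_dist_unique: "at_dist m z \<Longrightarrow> at_dist n z \<Longrightarrow> m = n"
  unfolding at_dist_def by (meson linorder_neqE_nat)

lemma at_dist_nonadj:
  assumes "at_dist m x" "at_dist n y" "m + 2 \<le> n" "x \<in> V - Q" "y \<in> V - Q"
  shows "\<not> x \<sim> y"
proof
  assume "x \<sim> y"
  then have "(a, y) \<in> R ^^ Suc m"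
    using assms relpow_Suc_I[of a x m R y] unfolding at_dist_def by blast
  moreover have "Suc m < n" using assms by simp
  ultimately show False using assms unfolding at_dist_def by blast
qed

lemma at_dist_cases: "at_dist n z \<Longrightarrow> full z \<or> (\<exists>c. misses z c)"
proof (induction n arbitrary: z rule: less_induct)
  case (less n)
  show ?case
  proof (cases n)
    case 0
    then have "z = a" using less.prems by (auto simp: at_dist_def)
    then show ?thesis using full_ends by simp
  next
    case (Suc k)
    then obtain w where w: "at_dist k w" "w \<sim> z" "w \<in> V - Q" "z \<in> V - Q"
      using less.prems at_dist_pred by blast
    consider "full w" | c where "misses w c"
      using less.IH[of k w] w Suc by auto
    then show ?thesis
    proof cases
      case 1
      obtain e where e: "full e" "\<not> w \<sim> e" "w \<noteq> e" using full_nonadj_end[OF 1] .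
      \<comment> \<open>Diamond \<open>w\<close>, \<open>b\<close>, \<open>c\<close>,
        \<open>e\<close> with \<open>z\<close> hanging on \<open>w\<close>. If
        \<open>z \<sim> e\<close>, the 4-cycle \<open>z\<close>, \<open>w\<close>, \<open>b\<close>,
        \<open>e\<close> forces \<open>z \<sim> b\<close>.\<close>
      have "z \<sim> b \<or> z \<sim> c" if "b \<in> Q" "c \<in> Q" "b \<noteq> c" for b c
        using kite[of w b c e z] C4[of z w b e] that e w 1 Q_clique sym unfolding full_def by blast
      then show ?thesis using at_most_one_missed w by blast
    next
      case (2 c)
      have "w \<noteq> a" using 2 full_ends(1) not_full_and_misses by blast
      then obtain l where l: "k = Suc l" using w(1) by (cases k) (auto simp: at_dist_def)
      then obtain u where u: "at_dist l u" "u \<sim> w" "u \<in> V - Q"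
        using w at_dist_pred by blast
      have uz: "\<not> u \<sim> z" using at_dist_nonadj[of l u n z] u w less.prems Suc l by simp
      have "u \<noteq> z" using at_dist_unique[of l u n] u less.prems Suc l by auto
      have "full u \<or> (\<exists>c. misses u c)" using less.IH[of l u] u Suc l by auto
      then consider "full u" | "misses u c" using misses_nonadj 2 u by blast
      then have "z \<sim> b" if b: "b \<in> Q - {c}" for b
      proof cases
        case 1
        \<comment> \<open>Diamond \<open>w\<close>, \<open>u\<close>, \<open>b\<close>,
          \<open>c\<close> with \<open>z\<close> hanging on \<open>w\<close>:
          \<open>z \<sim> u\<close> fails by distance, and \<open>z \<sim> c\<close> would make
          \<open>z\<close>, \<open>c\<close>, \<open>u\<close>, \<open>w\<close> an induced
          4-cycle.\<close>
        have "u \<sim> c" "u \<sim> b" "w \<sim> b" "\<not> w \<sim> c" "w \<noteq> c" "b \<sim> c"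
          using 1 2 b Q_clique unfolding full_def misses_def by auto
        then show ?thesis
          using kite[of w u b c z] C4[of z c u w] uz \<open>u \<noteq> z\<close> b w u sym by blast
      next
        case u2: 2
        \<comment> \<open>Now \<open>u\<close> misses \<open>c\<close>, so a vertex \<open>t\<close>
          one step further back replaces \<open>c\<close> as far end of the diamond;
          \<open>t\<close> and \<open>u\<close> are too close to \<open>a\<close> to be adjacent to
          \<open>z\<close>.\<close>
        have "u \<noteq> a" using u2 full_ends(1) not_full_and_misses by blast
        then obtain i where i: "l = Suc i" using u(1) by (cases l) (auto simp: at_dist_def)
        then obtain t where t: "at_dist i t" "t \<sim> u" "t \<in> V - Q"
          using u at_dist_pred by blast
        have tz: "\<not> t \<sim> z" "\<not> t \<sim> w" 
          using at_dist_nonadj[of i t n z] at_dist_nonadj[of i t k w] t w less.prems Suc l i by auto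
        have "t \<noteq> w" using at_dist_unique[of i t k] t w l i by auto
        have "full t \<or> (\<exists>c. misses t c)" using less.IH[of i t] t Suc l i by auto
        then have "full t \<or> misses t c" using misses_nonadj u2 t by blast
        then have "t \<sim> b" "u \<sim> b" "w \<sim> b" using b 2 u2 unfolding full_def misses_def by auto
        then show ?thesis
          using kite[of w u b t z] uz tz \<open>u \<noteq> z\<close> \<open>t \<noteq> w\<close> b w u t sym by blast
      qed
      then show ?thesis using at_most_one_missed w by blast
    qed
  qed
qed

lemma Q_is_clique: "is_clique V E Q"
  using Q_clique in_V unfolding is_clique_def common_def by blast

lemma outside_Q_cases:
  assumes "z \<in> V - Q"
  shows "full z \<or> (\<exists>c. misses z c)"
proof -
  have "(a, z) \<in> R\<^sup>*"
    using no_cutset[OF Q_is_clique] full_ends assms unfolding full_def by blast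
  then have "\<exists>n. (a, z) \<in> R ^^ n" by (simp add: rtrancl_power)
  then have "at_dist (LEAST n. (a, z) \<in> R ^^ n) z"
    unfolding at_dist_def by (metis (mono_tags, lifting) LeastI_ex not_less_Least)
  then show ?thesis by (rule at_dist_cases)
qed

text \<open>Leaving the vertices that miss \<open>c\<close> within \<open>G - Q\<close> leads to a
  full vertex \<open>w\<close>, which must be adjacent to \<open>y\<close>. The clique
  \<open>insert w Q\<close> does not separate either, and a second exit yields a larger common
  neighbourhood or a kite.\<close>

lemma missed_unique:
  assumes x: "misses x c" and y: "misses y b"
  shows "b = c"
proof (rule ccontr)
  assume bc: "b \<noteq> c"
  have xV: "x \<in> V - Q" "y \<in> V - Q" "b \<in> Q" "c \<in> Q" "b \<sim> c"
    using x y bc Q_clique unfolding misses_def by auto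
  have "(x, y) \<in> R\<^sup>*" using no_cutset[OF Q_is_clique xV(1,2)] .
  moreover have "\<not> misses y c" using y bc unfolding misses_def by auto
  ultimately obtain x' w where x'w: "(x', w) \<in> R" "misses x' c" "\<not> misses w c"
    using rtrancl_exit[of x y R "{z. misses z c}"] x by blast
  \<comment> \<open>The exit vertex does not miss \<open>c\<close>, and being adjacent to
    \<open>x'\<close> it cannot miss another element.\<close>
  have w: "full w" using outside_Q_cases[of w] x'w misses_nonadj by blast
  have "x' \<sim> w" "x' \<sim> b" "\<not> x' \<sim> c" "y \<sim> c" "\<not> y \<sim> b" "w \<sim> b" "w \<sim> c" "x' \<noteq> c" "y \<noteq> b" "y \<noteq> w"
    using x'w w y bc xV unfolding full_def misses_def by auto
  moreover have "\<not> y \<sim> x'" using misses_nonadj[OF y x'w(2)] bc by blast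
  \<comment> \<open>Diamond \<open>c\<close>, \<open>w\<close>, \<open>b\<close>, \<open>x'\<close>
    with \<open>y\<close> hanging on \<open>c\<close>; of the other three vertices only
    \<open>w\<close> can be adjacent to \<open>y\<close>.\<close>
  ultimately have "w \<sim> y"
    using kite[of c w b x' y] \<open>b \<sim> c\<close> by (metis sym)
  \<comment> \<open>Leaving the neighbours of \<open>w\<close> that miss \<open>c\<close> inside \<open>G - K\<close> produces a further common
    neighbour of \<open>p\<close> and \<open>c\<close>, against the maximality of \<open>Q\<close>.\<close>
  obtain e where e: "full e" "\<not> w \<sim> e" "w \<noteq> e" using full_nonadj_end[OF w] .
  define K where "K = insert w Q"
  have K: "is_clique V E K"
    using Q_is_clique w sym unfolding K_def is_clique_def full_def by blast
  have x'K: "x' \<in> V - K" "e \<in> V - K"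
    using x'w e irrefl unfolding K_def misses_def full_def by auto
  define S where "S = {z. misses z c \<and> z \<sim> w}"
  have "x' \<in> S" "e \<notin> S"
    using x'w e(1) not_full_and_misses unfolding S_def by auto
  then obtain p q where exit: "(p, q) \<in> E \<inter> (V - K) \<times> (V - K)" "p \<in> S" "q \<notin> S"
    using rtrancl_exit[OF no_cutset[OF K x'K]] by metis
  have pq: "misses p c" "p \<sim> w" "\<not> (misses q c \<and> q \<sim> w)"
    using exit unfolding S_def by auto
  have q: "q \<in> V - Q" "q \<noteq> w" "p \<sim> q" using exit unfolding K_def by auto
  have "c' = c" if "misses q c'" for c'
    using misses_nonadj[OF pq(1) that] q(3) by blast
  then have "full q \<or> misses q c"
    using outside_Q_cases[OF q(1)] by blast
  then consider "full q" | "misses q c" "\<not> q \<sim> w"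
    using pq(3) by blast
  then show False
  proof cases
    case 1
    have "c \<sim> w" "c \<sim> q"
      using w 1 xV sym unfolding full_def by blast+
    moreover have "p \<sim> z \<and> c \<sim> z" if "z \<in> Q - {c}" for z
      using that pq(1) Q_clique[of c z] xV unfolding misses_def by auto
    ultimately have "insert w (insert q (Q - {c})) \<subseteq> common p c"
      using pq(2) q(3) unfolding common_def[of p c] by blast
    then have "card (insert w (insert q (Q - {c}))) \<le> card (common p c)"
      by (intro card_mono) auto
    moreover have "card (insert w (insert q (Q - {c}))) = Suc (card Q)"
      using w q xV two unfolding full_def by (simp add: card_Diff_singleton)
    ultimately have "card Q < card (common p c)" by simp
    moreover have "\<not> p \<sim> c" "p \<noteq> c" using pq(1) unfolding misses_def by auto
    ultimately show False using max[of p c] two by force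
  next
    case 2
    \<comment> \<open>Diamond \<open>w\<close>, \<open>p\<close>, \<open>b\<close>, \<open>q\<close>
      with \<open>y\<close> hanging on \<open>w\<close>: an induced kite.\<close>
    have "p \<sim> b" "q \<sim> b" "y \<noteq> p" "\<not> y \<sim> b" "y \<noteq> b"
      using 2 pq y bc xV unfolding misses_def by auto
    moreover have "\<not> y \<sim> p" "\<not> y \<sim> q"
      using misses_nonadj[OF y pq(1)] misses_nonadj[OF y 2(1)] bc by auto
    ultimately show False
      using kite[of w p b q y] 2 pq(2) q \<open>w \<sim> y\<close> \<open>w \<sim> b\<close> by (metis sym)
  qed
qed

lemma universal_vertex: obtains u where "u \<in> V" "\<And>x. x \<in> V - {u} \<Longrightarrow> u \<sim> x"
proof -
  obtain b where b: "b \<in> Q" "\<And>z. \<not> misses z b"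
    using another_in_Q missed_unique by metis
  have "b \<sim> x" if "x \<in> V - {b}" for x
    using outside_Q_cases[of x] that b Q_clique sym unfolding full_def misses_def by blast
  then show thesis using that b in_V unfolding common_def by blast
qed

end

context C4_kite_free
begin

text \<open>Common neighbourhoods have bounded size, so among the pairs of this kind some pair
  attains the maximum, and \<open>universal_vertex\<close> applies to it.\<close>

lemma two_common_nbrs_universal:
  assumes "x \<sim> p" "x \<sim> q" "y \<sim> p" "y \<sim> q" "x \<noteq> y" "p \<noteq> q" "\<not> x \<sim> y"
  obtains u where "u \<in> V" "\<And>z. z \<in> V - {u} \<Longrightarrow> u \<sim> z"
proof -
  define P where "P = (\<lambda>(x, y). \<not> x \<sim> y \<and> x \<noteq> y \<and> 2 \<le> card (common x y))"
  have "card {p, q} \<le> card (common x y)"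
    using assms by (intro card_mono finite_common) (simp add: common_def)
  then have "P (x, y)" using assms unfolding P_def by auto
  moreover have "\<forall>z. P z \<longrightarrow> (case z of (x, y) \<Rightarrow> card (common x y)) < Suc (card V)"
  proof -
    have "card (common x y) \<le> card V" for x y
      using graph by (intro card_mono) (auto simp: graph_def common_def)
    then show ?thesis by (auto simp: less_Suc_eq_le)
  qed
  ultimately obtain z where z: "P z"
    "\<And>y. P y \<Longrightarrow> (case y of (x, y) \<Rightarrow> card (common x y)) \<le> (case z of (x, y) \<Rightarrow> card (common x y))"
    using ex_has_greatest_nat[of P "(x, y)" "\<lambda>(x, y). card (common x y)"] by blast
  obtain a d where ad: "z = (a, d)" by (cases z)
  interpret max_common_nbrs V E a d
    using z unfolding ad P_def by unfold_locales force+
  show thesis using universal_vertex that by blast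
qed

end

section \<open>Searching for the Petersen graph\<close>

text \<open>A graph on \<open>{..<length g}\<close> is given by the list \<open>g\<close> whose \<open>i\<close>-th entry lists the neighbours of
\<open>i\<close> below \<open>i\<close>, so that a vertex with neighbourhood \<open>S\<close> is added by appending \<open>S\<close>.\<close>

definition adj :: "nat list list \<Rightarrow> nat \<Rightarrow> nat \<Rightarrow> bool" where
  "adj g i j \<longleftrightarrow> j \<in> set (g ! i) \<or> i \<in> set (g ! j)"

definition common_nbr :: "nat list list \<Rightarrow> nat \<Rightarrow> nat \<Rightarrow> nat \<Rightarrow> bool" where
  "common_nbr g i j k \<longleftrightarrow> adj g i k \<and> adj g j k"

text \<open>In the next two definitions \<open>S\<close> is the neighbourhood of a vertex to be added to \<open>g\<close>.\<close>

fun C4_free_nbhds :: "nat list list \<Rightarrow> nat list \<Rightarrow> nat list list" where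
  "C4_free_nbhds g [] = [[]]"
| "C4_free_nbhds g (i # is) =
    (let R = C4_free_nbhds g is
     in R @ map ((#) i) (filter (\<lambda>S. \<forall>j\<in>set S. adj g i j \<or>
          \<not> (\<exists>k<length g. common_nbr g i j k)) R))"

definition diamond_free_nbhd :: "nat list list \<Rightarrow> nat list \<Rightarrow> bool" where
  "diamond_free_nbhd g S \<longleftrightarrow> (\<forall>i\<in>set S. \<forall>j\<in>set S. adj g i j \<longrightarrow>
     (\<forall>k<length g. common_nbr g i j k \<longrightarrow> k \<in> set S))"

fun induced_path :: "nat list list \<Rightarrow> nat list \<Rightarrow> bool" where
  "induced_path g (x # y # p) \<longleftrightarrow>
     x < length g \<and> x \<noteq> y \<and> adj g x y \<and> (\<forall>z\<in>set p. \<not> adj g x z \<and> z \<noteq> x) \<and> induced_path g (y # p)"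
| "induced_path g [x] \<longleftrightarrow> x < length g"
| "induced_path g [] \<longleftrightarrow> True"

text \<open>The lists in \<open>ps\<close> are mere hints: length and inducedness are checked here,
  so a wrong list excludes nothing.\<close>

definition viable :: "nat \<Rightarrow> nat list list \<Rightarrow> nat list list \<Rightarrow> nat list \<Rightarrow> bool" where
  "viable t g ps S \<longleftrightarrow> diamond_free_nbhd g S \<and>
     \<not> (\<exists>p\<in>set ps. length p = t \<and> induced_path (g @ [S]) p)"

text \<open>\<open>petersen_E\<close> in the lower-neighbour encoding, see
  \<open>petersen_E_iff\<close>.\<close>

definition petersen_graph :: "nat list list" where
  "petersen_graph = [[], [0], [1], [2], [0, 3], [0], [1], [2, 5], [3, 5, 6], [4, 6, 7]]"

definition petersen_numbering :: "nat list list \<Rightarrow> nat list \<Rightarrow> bool" where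
  "petersen_numbering g q \<longleftrightarrow> length g = 10 \<and> length q = 10 \<and> distinct q \<and>
     (\<forall>i<10. q ! i < 10 \<and>
       (\<forall>j<10. adj g (q ! i) (q ! j) \<longleftrightarrow> adj petersen_graph i j))"

text \<open>The search keeps a stack of graphs. \<open>Extend v u ps\<close> is legitimate when at most one neighbour of \<open>v\<close>
lies outside the closed neighbourhood of \<open>u\<close>: then there is another one in the ambient graph, and it
is added in all possible ways. The lists \<open>ps\<close> are induced paths on \<open>t\<close> vertices, which rule out
candidate neighbourhoods. \<open>Petersen q ps\<close> exhibits a numbering of the graph as the
Petersen graph and rules out that any further vertex is attached to it.\<close>

datatype step = Extend nat nat "nat list list" | Petersen "nat list" "nat list list"

fun search :: "nat \<Rightarrow> nat list list list \<Rightarrow> step list \<Rightarrow> bool" where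
  "search t [] ss \<longleftrightarrow> True"
| "search t (g # gs) [] \<longleftrightarrow> False"
| "search t (g # gs) (Extend v u ps # ss) \<longleftrightarrow>
     v < length g \<and> u < length g \<and> adj g v u \<and>
     length (filter (\<lambda>x. adj g v x \<and> \<not> adj g u x \<and> x \<noteq> u) [0..<length g]) \<le> 1 \<and>
     search t (map (\<lambda>S. g @ [S])
       (filter (\<lambda>S. v \<in> set S \<and> u \<notin> set S \<and> viable t g ps S)
         (C4_free_nbhds g [0..<length g])) @ gs) ss"
| "search t (g # gs) (Petersen q ps # ss) \<longleftrightarrow>
     petersen_numbering g q \<and>
     filter (viable t g ps) (C4_free_nbhds g [0..<length g]) = [[]] \<and>
     search t gs ss"

text \<open>The two certificates were found by computer, extending at a pair \<open>v\<close>, \<open>u\<close> with few viable extensions.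
The first one starts from the path on 6 vertices, the second one from an edge.\<close>

lemma search_P7: "search 7 [[[], [0], [1], [2], [3], [4]]]
    [Extend 0 1 [[5, 4, 3, 2, 1, 0, 6]],
     Extend 0 1 [[5, 4, 3, 2, 1, 0, 7]],
     Extend 2 1 [[5, 4, 7, 0, 1, 2, 8], [0, 6, 5, 4, 3, 2, 8], [3, 2, 8, 5, 6, 0, 7]],
     Extend 1 0 [[0, 6, 8, 2, 3, 4, 9], [3, 4, 5, 6, 0, 1, 9]],
     Extend 3 2 [[5, 6, 0, 1, 2, 3, 10], [0, 10, 3, 2, 8, 5, 9], [0, 1, 9, 5, 4, 3, 10]],
     Extend 5 4 [[1, 0, 7, 3, 4, 5, 8], [0, 1, 2, 3, 4, 5, 8], [2, 3, 7, 0, 6, 5, 8]],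
     Extend 1 2 [[3, 2, 8, 5, 6, 0, 9], [3, 4, 5, 6, 0, 1, 9]],
     Extend 2 1 [[0, 1, 8, 5, 4, 3, 10], [0, 6, 5, 4, 3, 2, 10], [0, 6, 10, 2, 3, 4, 9]],
     Extend 0 6 [[2, 3, 4, 5, 6, 0, 8], [2, 1, 8, 4, 5, 6, 7]],
     Extend 2 1 [[4, 5, 6, 0, 1, 2, 9], [1, 0, 7, 3, 4, 5, 9], [1, 2, 9, 6, 5, 4, 8]],
     Extend 1 2 [[2, 3, 7, 0, 6, 5, 8], [6, 5, 4, 3, 2, 1, 8]],
     Extend 3 4 [[1, 0, 6, 5, 4, 3, 9], [1, 2, 9, 6, 5, 4, 7], [2, 1, 8, 4, 5, 6, 9]],
     Extend 0 1 [[5, 4, 3, 2, 1, 0, 7]],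
     Extend 2 1 [[5, 4, 6, 0, 1, 2, 8], [0, 7, 5, 4, 3, 2, 8], [3, 2, 8, 5, 7, 0, 6]],
     Extend 1 0 [[0, 7, 8, 2, 3, 4, 9], [3, 4, 5, 7, 0, 1, 9]],
     Extend 3 2 [[5, 7, 0, 1, 2, 3, 10], [0, 10, 3, 2, 8, 5, 9], [0, 1, 9, 5, 4, 3, 10]],
     Extend 2 1 [[5, 4, 6, 0, 1, 2, 8], [1, 0, 7, 3, 4, 5, 8]],
     Extend 5 4 [[0, 1, 2, 3, 4, 5, 9], [0, 9, 5, 4, 3, 2, 8], [2, 9, 5, 4, 6, 0, 7]],
     Extend 5 4 [[0, 1, 2, 3, 4, 5, 10], [0, 7, 3, 2, 10, 5, 9], [0, 10, 5, 4, 3, 2, 8]],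
     Extend 0 1 [[5, 4, 3, 2, 1, 0, 7]],
     Extend 5 4 [[0, 1, 2, 3, 4, 5, 8], [1, 0, 7, 3, 4, 5, 8], [2, 3, 7, 0, 6, 5, 8]],
     Extend 5 4 [[0, 1, 2, 3, 4, 5, 9]],
     Extend 2 1 [[1, 0, 6, 3, 4, 5, 7]],
     Extend 6 3 [[0, 1, 2, 3, 4, 5, 8], [5, 4, 3, 2, 1, 0, 8], [0, 8, 5, 4, 3, 2, 7]],
     Extend 0 1 [[5, 4, 3, 2, 1, 0, 9], [0, 9, 5, 4, 3, 2, 7], [5, 9, 7, 2, 3, 6, 8], [5, 4, 9, 0, 1, 2, 7], [5, 9, 0, 6, 3, 2, 7]],
     Extend 0 6 [[2, 3, 4, 5, 9, 0, 10], [1, 2, 7, 9, 5, 4, 10], [1, 10, 4, 3, 6, 9, 7]],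
     Extend 1 0 [[1, 10, 8, 6, 3, 4, 9], [1, 10, 5, 4, 3, 6, 8], [2, 7, 9, 0, 6, 8, 10], [5, 4, 3, 6, 0, 1, 10], [5, 4, 10, 1, 0, 6, 8], [5, 10, 1, 2, 3, 6, 8]],
     Extend 5 4 [[0, 1, 2, 3, 4, 5, 9], [7, 8, 6, 3, 4, 5, 9], [0, 6, 3, 4, 5, 9, 7], [0, 9, 5, 4, 3, 2, 7]],
     Extend 0 1 [[1, 9, 8, 6, 3, 4, 10], [3, 4, 5, 9, 1, 0, 10], [0, 10, 5, 4, 3, 2, 7], [2, 3, 6, 0, 10, 5, 9]],
     Extend 1 0 [[0, 9, 7, 2, 3, 4, 10], [3, 4, 5, 9, 0, 1, 10], [1, 10, 5, 4, 3, 6, 8], [2, 3, 6, 0, 9, 5, 10]],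
     Extend 0 6 [[2, 3, 4, 5, 8, 0, 9], [1, 2, 7, 8, 5, 4, 9], [1, 9, 4, 3, 6, 8, 7]],
     Extend 2 3 [[0, 1, 8, 5, 4, 3, 7], [1, 0, 6, 3, 4, 5, 8], [5, 4, 3, 6, 0, 1, 8]],
     Extend 5 4 [[0, 1, 2, 3, 4, 5, 9], [0, 9, 5, 4, 3, 2, 8], [0, 1, 9, 5, 4, 3, 7], [1, 0, 6, 3, 4, 5, 9], [1, 0, 9, 5, 4, 3, 7]],
     Extend 0 1 [[5, 4, 3, 2, 1, 0, 7]],
     Extend 1 2 [[2, 3, 6, 0, 7, 5, 8], [7, 5, 4, 3, 2, 1, 8]],
     Extend 3 4 [[1, 0, 7, 5, 4, 3, 9], [1, 2, 9, 7, 5, 4, 6], [2, 1, 8, 4, 5, 7, 9]]]"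
  by code_simp

lemma search_P6: "search 6 [[[], [0]]]
    [Extend 0 1 [],
     Extend 1 0 [],
     Extend 0 1 [],
     Extend 1 0 [],
     Extend 2 0 [],
     Extend 3 1 [[2, 6, 7, 3, 1, 5], [6, 2, 0, 1, 3, 7], [4, 0, 1, 3, 7, 6], [5, 1, 3, 7, 2, 6]],
     Extend 2 0 [[4, 0, 1, 5, 6, 7], [3, 1, 5, 6, 2, 7]],
     Extend 3 1 [[2, 6, 5, 1, 3, 8], [3, 8, 6, 2, 0, 4]],
     Extend 4 0 [[3, 7, 2, 0, 4, 9], [1, 5, 6, 2, 7, 9]],
     Petersen [0, 1, 3, 7, 2, 4, 5, 8, 9, 6] [[0, 1, 3, 7, 9, 10], [0, 1, 3, 8, 6, 10], [0, 1, 5, 6, 8, 10], [0, 1, 5, 9, 7, 10], [2, 6, 8, 3, 1, 10], [6, 8, 3, 1, 0, 10], [0, 2, 6, 8, 3, 10], [0, 2, 6, 5, 9, 10], [0, 2, 7, 3, 8, 10], [0, 2, 7, 9, 5, 10], [1, 3, 7, 9, 4, 10], [1, 3, 8, 6, 2, 10]],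
     Extend 2 0 [[4, 0, 1, 3, 6, 7], [5, 1, 3, 6, 2, 7]],
     Extend 3 1 [[2, 7, 5, 1, 3, 8], [3, 8, 7, 2, 0, 4]],
     Extend 4 0 [[3, 6, 2, 0, 4, 9], [1, 5, 7, 2, 6, 9]],
     Petersen [0, 1, 3, 6, 2, 4, 5, 8, 9, 7] [[0, 1, 3, 6, 9, 10], [0, 1, 3, 8, 7, 10], [0, 1, 5, 7, 8, 10], [0, 1, 5, 9, 6, 10], [2, 6, 9, 5, 1, 10], [6, 9, 5, 1, 0, 10], [0, 2, 6, 9, 5, 10], [0, 2, 6, 3, 8, 10], [0, 2, 7, 5, 9, 10], [0, 2, 7, 8, 3, 10], [1, 3, 6, 9, 4, 10], [1, 3, 8, 7, 2, 10]],
     Extend 2 0 [[3, 5, 6, 2, 0, 4], [4, 0, 2, 6, 3, 5]],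
     Extend 3 1 [[0, 2, 6, 7, 3, 5], [4, 0, 2, 7, 3, 5], [6, 2, 0, 1, 3, 7]],
     Extend 2 0 [],
     Extend 3 1 [[4, 0, 1, 3, 6, 5], [5, 2, 0, 1, 3, 6]],
     Extend 1 3 [[4, 2, 6, 3, 1, 7]],
     Extend 1 3 [[4, 2, 5, 3, 1, 6]]]"
  by code_simp

section \<open>Soundness of the search\<close>

definition embeds :: "'a set \<Rightarrow> ('a \<times> 'a) set \<Rightarrow> (nat \<Rightarrow> 'a) \<Rightarrow> nat list list \<Rightarrow> bool" where
  "embeds V E f g \<longleftrightarrow>
     (\<forall>N\<in>set g. set N \<subseteq> {..<length g}) \<and> inj_on f {..<length g} \<and> f ` {..<length g} \<subseteq> V \<and>
     (\<forall>i<length g. \<forall>j<length g. (f i, f j) \<in> E \<longleftrightarrow> adj g i j)"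

lemma path_E_iff: "(i, j) \<in> path_E t \<longleftrightarrow> i < t \<and> j < t \<and> (j = Suc i \<or> i = Suc j)"
  by (auto simp: path_E_def symc_def)

lemma induced_path_nth:
  assumes "induced_path g p" "i < j" "j < length p"
  shows "p ! i \<noteq> p ! j \<and> (adj g (p ! i) (p ! j) \<longleftrightarrow> j = Suc i)"
  using assms
proof (induction g p arbitrary: i j rule: induced_path.induct)
  case (1 g x y p)
  obtain k where k: "j = Suc k" using 1 by (cases j) auto
  show ?case
  proof (cases i)
    case 0
    then show ?thesis using 1 k by (cases k) auto
  next
    case (Suc l)
    then show ?thesis using 1 k by auto
  qed
qed auto

lemma induced_path_length: "induced_path g p \<Longrightarrow> i < length p \<Longrightarrow> p ! i < length g"
proof (induction g p arbitrary: i rule: induced_path.induct)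
  case (1 g x y p)
  then show ?case by (cases i) auto
qed auto

lemma petersen_E_iff:
  "i < 10 \<Longrightarrow> j < 10 \<Longrightarrow> (i, j) \<in> petersen_E \<longleftrightarrow> adj petersen_graph i j"
proof -
  have "petersen_E = symc ((\<lambda>i. (i, (i + 1) mod 5)) ` set [0..<5] \<union> (\<lambda>i. (i, i + 5)) ` set [0..<5]
      \<union> (\<lambda>i. (i + 5, (i + 2) mod 5 + 5)) ` set [0..<5])"
    unfolding petersen_E_def by (rule arg_cong[where f = symc]) auto
  moreover have "\<forall>i<10. \<forall>j<10.
      (i, j) \<in> symc ((\<lambda>i. (i, (i + 1) mod 5)) ` set [0..<5] \<union> (\<lambda>i. (i, i + 5)) ` set [0..<5]
      \<union> (\<lambda>i. (i + 5, (i + 2) mod 5 + 5)) ` set [0..<5]) \<longleftrightarrow> adj petersen_graph i j"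
    unfolding symc_def by code_simp
  ultimately show "i < 10 \<Longrightarrow> j < 10 \<Longrightarrow> ?thesis" by blast
qed

text \<open>What remains once the universal vertices are gone. \<open>unique\<close> excludes
  induced 4-cycles and diamonds together; \<open>two_private_nbrs\<close> is the local form of the
  degree bound.\<close>

locale unique_common_nbr =
  fixes V :: "'a set" and E :: "('a \<times> 'a) set"
  assumes graph: "graph V E"
    and unique: "\<lbrakk>(x, p) \<in> E; (x, q) \<in> E; (y, p) \<in> E; (y, q) \<in> E; x \<noteq> y; p \<noteq> q\<rbrakk> \<Longrightarrow> (x, y) \<in> E"
    and connected: "\<lbrakk>x \<in> V; y \<in> V\<rbrakk> \<Longrightarrow> (x, y) \<in> E\<^sup>*"
    and two_private_nbrs: "(v, u) \<in> E \<Longrightarrow> 2 \<le> card {x. (v, x) \<in> E \<and> (u, x) \<notin> E \<and> x \<noteq> u}"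
begin

lemma sym: "(x, y) \<in> E \<Longrightarrow> (y, x) \<in> E"
  using graph by (auto simp: graph_def dest: symD)

lemma irrefl: "(x, x) \<notin> E"
  using graph by (auto simp: graph_def)

lemma in_V: "(x, y) \<in> E \<Longrightarrow> x \<in> V" "(x, y) \<in> E \<Longrightarrow> y \<in> V"
  using graph by (auto simp: graph_def)

definition nbhd :: "(nat \<Rightarrow> 'a) \<Rightarrow> nat list list \<Rightarrow> 'a \<Rightarrow> nat list" where
  "nbhd f g x = filter (\<lambda>i. (f i, x) \<in> E) [0..<length g]"

context
  fixes f :: "nat \<Rightarrow> 'a" and g :: "nat list list"
  assumes f: "embeds V E f g"
begin

lemma adj_E: "i < length g \<Longrightarrow> j < length g \<Longrightarrow> adj g i j \<longleftrightarrow> (f i, f j) \<in> E"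
  using f unfolding embeds_def by auto

lemma f_inj: "i < length g \<Longrightarrow> j < length g \<Longrightarrow> f i = f j \<longleftrightarrow> i = j"
  using f unfolding embeds_def by (auto simp: inj_on_def)

lemma induced_path_contains:
  assumes "induced_path g p"
  shows "contains_induced V E (path_V (length p)) (path_E (length p))"
proof -
  let ?h = "\<lambda>i. f (p ! i)"
  have *: "?h i \<noteq> ?h j \<and> ((?h i, ?h j) \<in> E \<longleftrightarrow> (i, j) \<in> path_E (length p))"
    if "i < j" "j < length p" for i j
    using induced_path_nth[OF assms that] induced_path_length[OF assms, of i]
      induced_path_length[OF assms, of j] that
    by (auto simp: path_E_iff adj_E f_inj)
  have "inj_on ?h (path_V (length p))"
    using * by (auto simp: path_V_def inj_on_def) (metis linorder_neqE_nat)
  moreover have "?h ` path_V (length p) \<subseteq> V"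
    using f induced_path_length[OF assms] unfolding embeds_def path_V_def by auto
  moreover have "(?h i, ?h j) \<in> E \<longleftrightarrow> (i, j) \<in> path_E (length p)"
    if "i < length p" "j < length p" for i j
  proof (cases i j rule: linorder_cases)
    case equal
    then show ?thesis by (simp add: irrefl path_E_iff)
  next
    case greater
    then show ?thesis using *[of j i] that sym by (auto simp: path_E_iff)
  qed (use * that in auto)
  ultimately show ?thesis
    unfolding contains_induced_def path_V_def by (intro exI[of _ ?h]) auto
qed

text \<open>Two neighbours of \<open>x\<close> with a common neighbour \<open>f k\<close> also share
  \<open>x\<close>, so \<open>unique\<close> makes them adjacent and the filter keeps the true
  neighbourhood.\<close>

lemma nbhd_C4_free:
  assumes "x \<notin> f ` {..<length g}" "distinct is" "set is \<subseteq> {..<length g}"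
  shows "filter (\<lambda>i. (f i, x) \<in> E) is \<in> set (C4_free_nbhds g is)"
  using assms(2,3)
proof (induction "is")
  case (Cons i "is")
  have *: "adj g i j \<or> \<not> common_nbr g i j k"
    if "(f i, x) \<in> E" "(f j, x) \<in> E" "j \<in> set is" "k < length g" for j k
  proof -
    have "i < length g" "j < length g" "i \<noteq> j" "x \<noteq> f k"
      using that Cons.prems assms(1) by auto
    then show ?thesis
      using that unique[of "f i" x "f k" "f j"]
      by (auto simp: common_nbr_def adj_E f_inj)
  qed
  have "\<forall>j\<in>set (filter (\<lambda>i. (f i, x) \<in> E) is).
      adj g i j \<or> \<not> (\<exists>k<length g. common_nbr g i j k)" if "(f i, x) \<in> E"
    using that by (auto dest: *)
  then show ?case
    using Cons by (auto simp: Let_def image_iff)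
qed simp

lemma nbhd_in_candidates:
  "x \<notin> f ` {..<length g} \<Longrightarrow> nbhd f g x \<in> set (C4_free_nbhds g [0..<length g])"
  unfolding nbhd_def by (rule nbhd_C4_free) auto

text \<open>\<open>f k\<close> and \<open>x\<close> share the neighbours \<open>f i\<close> and
  \<open>f j\<close>, hence are adjacent by \<open>unique\<close>.\<close>

lemma nbhd_diamond_free:
  assumes "x \<notin> f ` {..<length g}"
  shows "diamond_free_nbhd g (nbhd f g x)"
proof -
  have "(f k, x) \<in> E"
    if "i < length g" "j < length g" "k < length g" "adj g i j" "common_nbr g i j k"
      "(f i, x) \<in> E" "(f j, x) \<in> E" for i j k
    using that assms unique[of "f k" "f i" "f j" x] irrefl sym
    by (auto simp: common_nbr_def adj_E f_inj)
  then show ?thesis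
    unfolding diamond_free_nbhd_def nbhd_def by auto
qed

lemma embeds_extend:
  assumes "x \<in> V" "x \<notin> f ` {..<length g}"
  shows "embeds V E (f(length g := x)) (g @ [nbhd f g x])"
proof -
  let ?n = "length g" and ?g = "g @ [nbhd f g x]"
  have old: "adj ?g i j \<longleftrightarrow> adj g i j" if "i < ?n" "j < ?n" for i j
    using that by (simp add: adj_def nth_append)
  \<comment> \<open>Old entries stay below \<open>length g\<close>, so the new index occurs in none
    of them.\<close>
  have wf: "set (g ! i) \<subseteq> {..<?n}" if "i < ?n" for i
    using f that unfolding embeds_def by auto
  have new: "adj ?g i ?n \<longleftrightarrow> (f i, x) \<in> E" "adj ?g ?n i \<longleftrightarrow> (x, f i) \<in> E" if "i < ?n" for i
    using that wf[OF that] sym by (auto simp: adj_def nth_append nbhd_def)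
  have nn: "\<not> adj ?g ?n ?n" by (auto simp: adj_def nth_append nbhd_def)
  have "inj_on (f(?n := x)) {..<length ?g}"
    using assms f_inj by (auto simp: inj_on_def less_Suc_eq)
  moreover have "f(?n := x) ` {..<length ?g} \<subseteq> V"
    using assms f unfolding embeds_def by (auto simp: less_Suc_eq)
  moreover have "\<forall>N\<in>set ?g. set N \<subseteq> {..<length ?g}"
    using f unfolding embeds_def nbhd_def by force
  ultimately show ?thesis
    unfolding embeds_def using old new nn irrefl adj_E by (auto simp: less_Suc_eq)
qed

end

lemma viable_nbhd:
  assumes "embeds V E f g" "H_free V E (path_V t) (path_E t)" "x \<in> V" "x \<notin> f ` {..<length g}"
  shows "viable t g ps (nbhd f g x)"
proof -
  have "\<not> (length p = t \<and> induced_path (g @ [nbhd f g x]) p)" for p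
    using induced_path_contains[OF embeds_extend[OF assms(1,3,4)], of p] assms(2)
    unfolding H_free_def by blast
  then show ?thesis
    unfolding viable_def using nbhd_diamond_free[OF assms(1,4)] by blast
qed

text \<open>Pigeonhole: \<open>two_private_nbrs\<close> supplies two vertices, and at most one of
  them is already embedded.\<close>

lemma extension_vertex:
  assumes f: "embeds V E f g" and vu: "v < length g" "u < length g" "adj g v u"
    and "length (filter (\<lambda>x. adj g v x \<and> \<not> adj g u x \<and> x \<noteq> u) [0..<length g]) \<le> 1"
  obtains x where "x \<notin> f ` {..<length g}" "(f v, x) \<in> E" "(f u, x) \<notin> E"
proof -
  define X where "X = {x. (f v, x) \<in> E \<and> (f u, x) \<notin> E \<and> x \<noteq> f u}"
  define I where "I = {x. x < length g \<and> adj g v x \<and> \<not> adj g u x \<and> x \<noteq> u}"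
  have "I = set (filter (\<lambda>x. adj g v x \<and> \<not> adj g u x \<and> x \<noteq> u) [0..<length g])"
    unfolding I_def by auto
  then have "card I \<le> length (filter (\<lambda>x. adj g v x \<and> \<not> adj g u x \<and> x \<noteq> u) [0..<length g])"
    by (simp only: card_length)
  then have "card I \<le> 1" using assms(5) by (rule order_trans)
  have "finite I" unfolding I_def by simp
  have "(f v, f u) \<in> E" using adj_E[OF f] vu by simp
  then have "2 \<le> card X" unfolding X_def by (rule two_private_nbrs)
  moreover have "card X \<le> 1" if "X \<subseteq> f ` I"
    using card_mono[OF finite_imageI[OF \<open>finite I\<close>] that] card_image_le[OF \<open>finite I\<close>, of f]
      \<open>card I \<le> 1\<close> by linarith
  ultimately have "\<not> X \<subseteq> f ` I" by linarith
  then obtain x where x: "x \<in> X" "x \<notin> f ` I" by blast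
  have "i \<in> I" if "i < length g" "x = f i" for i
    using x(1) that vu unfolding X_def I_def by (auto simp: adj_E[OF f])
  then have "x \<notin> f ` {..<length g}" using x(2) by blast
  then show thesis using x that unfolding X_def by blast
qed

text \<open>If \<open>f\<close> were not onto, connectedness would give an outside vertex with a
  nonempty viable neighbourhood, against \<open>closed\<close>.\<close>

lemma petersen_iso:
  assumes f: "embeds V E f g" and q: "petersen_numbering g q"
    and closed: "filter (viable t g ps) (C4_free_nbhds g [0..<length g]) = [[]]"
    and P: "H_free V E (path_V t) (path_E t)"
  shows "graph_iso V E petersen_V petersen_E"
proof -
  have len: "length g = 10" "length q = 10" "distinct q" using q unfolding petersen_numbering_def by auto
  have onto: "f ` {..<10} = V"
  proof (rule ccontr)
    assume "f ` {..<10} \<noteq> V"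
    then obtain z where z: "z \<in> V" "z \<notin> f ` {..<10}" using f len unfolding embeds_def by auto
    have f0: "f 0 \<in> f ` {..<10}" by simp
    then have "f 0 \<in> V" using f len unfolding embeds_def by auto
    from rtrancl_exit[OF connected[OF this z(1)] f0 z(2)]
    obtain y x where yx: "(y, x) \<in> E" "y \<in> f ` {..<10}" "x \<notin> f ` {..<10}" .
    have "nbhd f g x \<noteq> []" using yx len unfolding nbhd_def by (auto simp: filter_empty_conv)
    moreover have "nbhd f g x \<in> set (filter (viable t g ps) (C4_free_nbhds g [0..<length g]))"
      using viable_nbhd[OF f P in_V(2)[OF yx(1)]] nbhd_in_candidates[OF f] yx len by auto
    ultimately show False unfolding closed by simp
  qed
  have q10: "q ! i < 10" if "i < 10" for i using q that unfolding petersen_numbering_def by auto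
  have "set q \<subseteq> {..<10}" using q10 len by (auto simp: set_conv_nth)
  then have set_q: "set q = {..<10}"
    using card_subset_eq[of "{..<10}" "set q"] distinct_card[OF len(3)] len by simp
  let ?h = "\<lambda>i. f (q ! i)"
  have h: "bij_betw ?h petersen_V V"
  proof -
    have "bij_betw ((!) q) {..<10} {..<10}"
      by (rule bij_betw_nth) (simp_all only: len set_q)
    moreover have "bij_betw f {..<10} V"
      using f len onto unfolding embeds_def bij_betw_def by simp
    ultimately have "bij_betw (f \<circ> (!) q) {..<10} V" by (rule bij_betw_trans)
    then show ?thesis by (simp add: petersen_V_def comp_def atLeast0LessThan)
  qed
  have h_adj: "(?h i, ?h j) \<in> E \<longleftrightarrow> (i, j) \<in> petersen_E" if "i \<in> petersen_V" "j \<in> petersen_V" for i j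
  proof -
    have ij: "i < 10" "j < 10" using that by (auto simp: petersen_V_def)
    then have "adj g (q ! i) (q ! j) \<longleftrightarrow> adj petersen_graph i j"
      using q unfolding petersen_numbering_def by blast
    then show ?thesis
      using adj_E[OF f, of "q ! i" "q ! j"] petersen_E_iff[OF ij] q10 ij len by simp
  qed
  \<comment> \<open>\<open>graph_iso\<close> wants a map from \<open>V\<close> to the Petersen
    graph, opposite to \<open>?h\<close>.\<close>
  define k where "k = inv_into petersen_V ?h"
  have "k x \<in> petersen_V" "f (q ! k x) = x" if "x \<in> V" for x
    using bij_betwE[OF bij_betw_inv_into[OF h]] bij_betw_inv_into_right[OF h] that
    unfolding k_def by blast+
  then have "(x, y) \<in> E \<longleftrightarrow> (k x, k y) \<in> petersen_E" if "x \<in> V" "y \<in> V" for x y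
    using that h_adj[of "k x" "k y"] by simp
  then show ?thesis
    unfolding graph_iso_def k_def using bij_betw_inv_into[OF h] by blast
qed

text \<open>At \<open>Extend\<close> the neighbourhood of an actual further vertex is among the
  pushed candidates. So some embedded graph stays on the stack until a \<open>Petersen\<close> step
  meets it.\<close>

lemma search_sound:
  assumes "search t gs ss" "H_free V E (path_V t) (path_E t)" "g \<in> set gs" "embeds V E f g"
  shows "graph_iso V E petersen_V petersen_E"
  using assms
proof (induction t gs ss arbitrary: f g rule: search.induct)
  case (3 t g gs v u ps ss f h)
  let ?gs = "map (\<lambda>S. g @ [S]) (filter (\<lambda>S. v \<in> set S \<and> u \<notin> set S \<and> viable t g ps S)
         (C4_free_nbhds g [0..<length g])) @ gs"
  have s: "v < length g" "u < length g" "adj g v u"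
    "length (filter (\<lambda>x. adj g v x \<and> \<not> adj g u x \<and> x \<noteq> u) [0..<length g]) \<le> 1" "search t ?gs ss"
    using "3.prems"(1) by auto
  note IH = "3.IH"[OF s(5) "3.prems"(2)]
  show ?case
  proof (cases "h \<in> set gs")
    case True
    then show ?thesis using IH "3.prems"(4) by auto
  next
    case False
    then have f: "embeds V E f g" using "3.prems"(3,4) by simp
    obtain x where x: "x \<notin> f ` {..<length g}" "(f v, x) \<in> E" "(f u, x) \<notin> E"
      using extension_vertex[OF f s(1-4)] .
    have "g @ [nbhd f g x] \<in> set ?gs"
      using viable_nbhd[OF f "3.prems"(2) in_V(2)[OF x(2)] x(1)] nbhd_in_candidates[OF f x(1)] x s
      by (auto simp: nbhd_def)
    then show ?thesis
      using IH embeds_extend[OF f in_V(2)[OF x(2)] x(1)] by blast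
  qed
next
  case (4 t g gs q ps ss f h)
  then show ?case
    using petersen_iso[of f g q t ps] by (cases "h = g") auto
qed auto

end

context unique_common_nbr
begin

lemma petersen_if_P7_free:
  assumes "H_free V E (path_V 7) (path_E 7)" and edge: "(x, y) \<in> E"
  shows "graph_iso V E petersen_V petersen_E"
proof (cases "H_free V E (path_V 6) (path_E 6)")
  case True
  have "x \<noteq> y" "(x, x) \<notin> E" "(y, y) \<notin> E" using edge irrefl by auto
  then have "embeds V E (\<lambda>i. if i = 0 then x else y) [[], [0]]"
    using in_V[OF edge] edge sym[OF edge]
    by (simp add: embeds_def adj_def inj_on_def All_less_Suc numeral_2_eq_2 lessThan_Suc)
  then show ?thesis using search_sound[OF search_P6 True] by simp
next
  case False
  then obtain f where f: "inj_on f (path_V 6)" "f ` path_V 6 \<subseteq> V"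
    "\<forall>i\<in>path_V 6. \<forall>j\<in>path_V 6. (f i, f j) \<in> E \<longleftrightarrow> (i, j) \<in> path_E 6"
    unfolding H_free_def contains_induced_def by blast
  define g :: "nat list list" where "g = [[], [0], [1], [2], [3], [4]]"
  have len: "length g = 6" and wf: "\<forall>N\<in>set g. set N \<subseteq> {..<length g}"
    by (simp_all add: g_def)
  then have six: "path_V 6 = {..<length g}" by (auto simp: path_V_def)
  have "\<forall>i<6. \<forall>j<6. (j = Suc i \<or> i = Suc j) \<longleftrightarrow> adj [[], [0], [1], [2], [3], [4]] i j"
    by code_simp
  then have "(i, j) \<in> path_E 6 \<longleftrightarrow> adj g i j" if "i < length g" "j < length g" for i j
    using that unfolding len path_E_iff g_def[symmetric] by blast
  then have "embeds V E f g"
    using f wf unfolding embeds_def six by simp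
  \<comment> \<open>\<open>search_P7\<close> has no \<open>Petersen\<close> step: every branch
    closes, so this case is in truth contradictory.\<close>
  then show ?thesis using search_sound[OF search_P7 assms(1)] by (simp add: g_def)
qed

end

section \<open>Removing the universal vertices\<close>

lemma contains_induced_subset:
  assumes "W \<subseteq> V" "contains_induced W (E \<inter> W \<times> W) X Y"
  shows "contains_induced V E X Y"
proof -
  obtain f where "inj_on f X" "f ` X \<subseteq> W" "\<forall>x\<in>X. \<forall>y\<in>X. (f x, f y) \<in> E \<inter> W \<times> W \<longleftrightarrow> (x, y) \<in> Y"
    using assms(2) unfolding contains_induced_def by blast
  then show ?thesis
    using assms(1) unfolding contains_induced_def by (intro exI[of _ f]) blast
qed

lemma cycle_E_4: "cycle_E 4 = symc {(0, 1), (1, 2), (2, 3), (3, 0)}"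
proof -
  have "{(i, (i + 1) mod 4) | i. i < 4} = (\<lambda>i. (i, (i + 1) mod 4)) ` {..<4 :: nat}" by auto
  also have "\<dots> = {(0, 1), (1, 2), (2, 3), (3, 0)}"
    by code_simp
  finally show ?thesis unfolding cycle_E_def by simp
qed

lemma C4_kite_freeI:
  assumes "graph V E" "H_free V E (cycle_V 4) (cycle_E 4)" "H_free V E kite_V kite_E"
    and "\<And>K x y. \<lbrakk>is_clique V E K; x \<in> V - K; y \<in> V - K\<rbrakk> \<Longrightarrow> (x, y) \<in> (E \<inter> (V - K) \<times> (V - K))\<^sup>*"
  shows "C4_kite_free V E"
proof
  have E: "E \<subseteq> V \<times> V" "\<And>x. (x, x) \<notin> E" and sym: "\<And>x y. (x, y) \<in> E \<Longrightarrow> (y, x) \<in> E"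
    using assms(1) by (auto simp: graph_def dest: symD)
  show "(a, c) \<in> E \<or> (b, d) \<in> E"
    if "(a, b) \<in> E" "(b, c) \<in> E" "(c, d) \<in> E" "(d, a) \<in> E" "a \<noteq> c" "b \<noteq> d" for a b c d
  proof (rule ccontr)
    assume "\<not> ?thesis"
    then have "(a, c) \<notin> E" "(c, a) \<notin> E" "(b, d) \<notin> E" "(d, b) \<notin> E"
      using sym by blast+
    moreover have "(b, a) \<in> E" "(c, b) \<in> E" "(d, c) \<in> E" "(a, d) \<in> E"
      using that sym by blast+
    moreover have "{a, b, c, d} \<subseteq> V" using that E(1) by auto
    moreover have "a \<noteq> b" "b \<noteq> c" "c \<noteq> d" "d \<noteq> a" using that E(2) by auto
    moreover have V4: "cycle_V 4 = {0, 1, 2, 3}" by (auto simp: cycle_V_def)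
    ultimately have "contains_induced V E (cycle_V 4) (cycle_E 4)"
      using that E(2) unfolding contains_induced_def V4 cycle_E_4 symc_def
      by (intro exI[of _ "(!) [a, b, c, d]"]) (simp add: inj_on_def)
    then show False using assms(2) by (simp add: H_free_def)
  qed
  show "(e, b) \<in> E \<or> (e, c) \<in> E \<or> (e, d) \<in> E"
    if "(a, b) \<in> E" "(a, c) \<in> E" "(b, c) \<in> E" "(b, d) \<in> E" "(c, d) \<in> E" "(a, d) \<notin> E" "a \<noteq> d"
      "(a, e) \<in> E" "e \<noteq> b" "e \<noteq> c" for a b c d e
  proof (rule ccontr)
    assume "\<not> ?thesis"
    then have "(e, b) \<notin> E" "(b, e) \<notin> E" "(e, c) \<notin> E" "(c, e) \<notin> E" "(e, d) \<notin> E" "(d, e) \<notin> E"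
      using sym by blast+
    moreover have "(b, a) \<in> E" "(c, a) \<in> E" "(c, b) \<in> E" "(d, b) \<in> E" "(d, c) \<in> E" "(e, a) \<in> E"
        "(d, a) \<notin> E"
      using that sym by blast+
    moreover have V5: "kite_V = {0, 1, 2, 3, 4}" by (auto simp: kite_V_def)
    moreover have "{a, b, c, d, e} \<subseteq> V" using that E(1) by auto
    moreover have "a \<noteq> b" "a \<noteq> c" "b \<noteq> c" "b \<noteq> d" "c \<noteq> d" "a \<noteq> e" "d \<noteq> e"
      using that E(2) by auto
    ultimately have "contains_induced V E kite_V kite_E"
      using that E(2) unfolding contains_induced_def V5 kite_E_def symc_def
      by (intro exI[of _ "(!) [a, b, c, d, e]"]) (simp add: inj_on_def)
    then show False using assms(3) by (simp add: H_free_def)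
  qed
  show "graph V E" by fact
  show "(x, y) \<in> (E \<inter> (V - K) \<times> (V - K))\<^sup>*"
    if "is_clique V E K" "x \<in> V - K" "y \<in> V - K" for K x y
    using that by (rule assms(4))
qed

text \<open>If \<open>x\<close> and \<open>y\<close> were separated, \<open>V - K\<close> would have
  two components against the single one of the graph.\<close>

lemma connected_if_no_clique_cutset:
  assumes "finite V" "connected_graph V E" "\<not> is_clique_cutset V E K" "is_clique V E K"
    and xy: "x \<in> V - K" "y \<in> V - K"
  shows "(x, y) \<in> (E \<inter> (V - K) \<times> (V - K))\<^sup>*"
proof (rule ccontr)
  define R where "R = E \<inter> (V - K) \<times> (V - K)"
  define C where "C = (\<lambda>x. {y \<in> V - K. (x, y) \<in> R\<^sup>*})"
  assume "(x, y) \<notin> (E \<inter> (V - K) \<times> (V - K))\<^sup>*"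
  then have "y \<notin> C x" "y \<in> C y" using xy unfolding C_def R_def by auto
  then have "C x \<noteq> C y" by metis
  then have two: "card {C x, C y} = 2" by simp
  have "R \<inter> (V - K) \<times> (V - K) = R" unfolding R_def by auto
  then have comp: "components (V - K) R = C ` (V - K)"
    unfolding components_def C_def by auto
  then have "{C x, C y} \<subseteq> components (V - K) R" "finite (components (V - K) R)"
    using xy assms(1) by auto
  then have "2 \<le> card (components (V - K) R)"
    using two card_mono[of "components (V - K) R" "{C x, C y}"] by simp
  then show False
    using assms(2-4) unfolding is_clique_cutset_def connected_graph_def R_def by simp
qed

text \<open>Any numbering of \<open>U\<close> serves, since its vertices are adjacent to all
  others.\<close>

lemma join_clique_iso:
  assumes "graph V E" "U \<subseteq> V" and univ: "\<And>u x. u \<in> U \<Longrightarrow> x \<in> V - {u} \<Longrightarrow> (u, x) \<in> E"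
    and "graph_iso (V - U) (E \<inter> (V - U) \<times> (V - U)) W F"
  shows "graph_iso V E (join_K_V (card U) W) (join_K_E (card U) W F)"
proof -
  have irrefl: "(x, x) \<notin> E" and sym: "(x, y) \<in> E \<Longrightarrow> (y, x) \<in> E" for x y
    using assms(1) by (auto simp: graph_def dest: symD)
  have "finite U" using assms(1,2) by (auto simp: graph_def intro: finite_subset)
  then obtain h where h: "bij_betw h U {0..<card U}"
    using ex_bij_betw_finite_nat by blast
  obtain g where g: "bij_betw g (V - U) W"
    "\<forall>x\<in>V - U. \<forall>y\<in>V - U. (x, y) \<in> E \<inter> (V - U) \<times> (V - U) \<longleftrightarrow> (g x, g y) \<in> F"
    using assms(4) unfolding graph_iso_def by blast
  define f where "f x = (if x \<in> U then Inl (h x) else Inr (g x))" for x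
  have "bij_betw f (U \<union> (V - U)) (Inl ` {0..<card U} \<union> Inr ` W)"
  proof (rule bij_betw_combine)
    have "bij_betw (Inl \<circ> h) U (Inl ` {0..<card U})"
      by (rule bij_betw_trans[OF h]) (simp add: bij_betw_def)
    then show "bij_betw f U (Inl ` {0..<card U})"
      by (rule iffD1[OF bij_betw_cong, rotated]) (simp add: f_def)
    have "bij_betw (Inr \<circ> g) (V - U) (Inr ` W)"
      by (rule bij_betw_trans[OF g(1)]) (simp add: bij_betw_def)
    then show "bij_betw f (V - U) (Inr ` W)"
      by (rule iffD1[OF bij_betw_cong, rotated]) (simp add: f_def)
  qed auto
  then have "bij_betw f V (join_K_V (card U) W)"
    using assms(2) by (simp add: join_K_V_def Un_absorb1)
  moreover have "(x, y) \<in> E \<longleftrightarrow> (f x, f y) \<in> join_K_E (card U) W F" if "x \<in> V" "y \<in> V" for x y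
  proof -
    have hU: "h x < card U" if "x \<in> U" for x using h that by (auto simp: bij_betw_def)
    have h_inj: "h x = h y \<longleftrightarrow> x = y" if "x \<in> U" "y \<in> U" for x y
      using h that by (auto simp: bij_betw_def inj_on_def)
    have gW: "g x \<in> W" if "x \<in> V - U" for x using g(1) that by (auto simp: bij_betw_def)
    consider "x \<in> U" "y \<in> U" | "x \<in> U" "y \<notin> U" | "x \<notin> U" "y \<in> U" | "x \<notin> U" "y \<notin> U" by blast
    then show ?thesis
    proof cases
      case 1
      then show ?thesis
        using that univ[of x y] irrefl hU h_inj by (auto simp: f_def join_K_E_def symc_def)
    next
      case 2
      then show ?thesis
        using that univ[of x y] hU gW by (auto simp: f_def join_K_E_def symc_def)
    next
      case 3
      then show ?thesis
        using that univ[of y x] sym hU gW by (auto simp: f_def join_K_E_def symc_def)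
    next
      case 4
      then show ?thesis
        using that g(2) by (auto simp: f_def join_K_E_def symc_def)
    qed
  qed
  ultimately show ?thesis unfolding graph_iso_def by blast
qed

theorem theorem1p2:
  fixes V :: "'a set" and E :: "('a \<times> 'a) set"
  assumes "graph V E"
    and "connected_graph V E"
    and "H_free V E (path_V 7) (path_E 7)"
    and "H_free V E (cycle_V 4) (cycle_E 4)"
    and "H_free V E kite_V kite_E"
    and "min_degree V E \<ge> clique_number V E + 1"
    and "\<not> (\<exists>K. is_clique_cutset V E K)"
  shows "\<exists>l::nat. graph_iso V E (join_K_V l petersen_V) (join_K_E l petersen_V petersen_E)
              \<or> graph_iso V E (join_K_V l F_V) (join_K_E l F_V F_E)"
proof -
  have finite: "finite V" and EV: "E \<subseteq> V \<times> V" and irrefl: "\<And>x. (x, x) \<notin> E"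
    and sym: "\<And>x y. (x, y) \<in> E \<Longrightarrow> (y, x) \<in> E"
    using assms(1) by (auto simp: graph_def dest: symD)
  have cut: "(x, y) \<in> (E \<inter> (V - K) \<times> (V - K))\<^sup>*"
    if "is_clique V E K" "x \<in> V - K" "y \<in> V - K" for K x y
    using connected_if_no_clique_cutset[OF finite assms(2)] assms(7) that by blast
  have degree: "card K + 1 \<le> card {y. (v, y) \<in> E}" if "is_clique V E K" "v \<in> V" for K v
  proof -
    have "{K. is_clique V E K} \<subseteq> Pow V" by (auto simp: is_clique_def)
    then have "card K \<le> clique_number V E"
      using that finite unfolding clique_number_def by (auto intro!: Max_ge intro: finite_subset)
    moreover have "min_degree V E \<le> degree V E v"
      using that finite unfolding min_degree_def by (auto intro!: Min_le)
    moreover have "{y \<in> V. (v, y) \<in> E} = {y. (v, y) \<in> E}" using EV by auto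
    ultimately show ?thesis using assms(6) by (simp add: degree_def)
  qed
  define U where "U = {u \<in> V. \<forall>x\<in>V - {u}. (u, x) \<in> E}"
  define W where "W = V - U"
  define E' where "E' = E \<inter> W \<times> W"
  have UW: "W \<subseteq> V" "U \<subseteq> V" "U \<inter> W = {}" "V = U \<union> W" unfolding U_def W_def by auto
  have U_adj: "(u, x) \<in> E" if "u \<in> U" "x \<in> V" "x \<noteq> u" for u x
    using that unfolding U_def by auto
  \<comment> \<open>Both the cutset condition and the degree bound pass to the graph on
    \<open>W\<close> through this lifting of cliques.\<close>
  have clique_Un: "is_clique V E (K \<union> U)" if "is_clique W E' K" for K
    using that U_adj sym UW unfolding is_clique_def E'_def by blast
  have P7: "H_free W E' (path_V 7) (path_E 7)"
    using assms(3) contains_induced_subset[OF UW(1)] unfolding H_free_def E'_def by blast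
  have W_cut: "(x, y) \<in> (E' \<inter> (W - K) \<times> (W - K))\<^sup>*"
    if "is_clique W E' K" "x \<in> W - K" "y \<in> W - K" for K x y
  proof -
    have "V - (K \<union> U) = W - K" unfolding W_def by auto
    moreover have "E \<inter> (W - K) \<times> (W - K) = E' \<inter> (W - K) \<times> (W - K)" unfolding E'_def by auto
    ultimately show ?thesis using cut[OF clique_Un[OF that(1)], of x y] that by simp
  qed
  have "graph W E'"
    using assms(1) finite_subset[OF UW(1)] unfolding graph_def E'_def sym_def by auto
  moreover have "H_free W E' (cycle_V 4) (cycle_E 4)" "H_free W E' kite_V kite_E"
    using assms(4,5) contains_induced_subset[OF UW(1)] unfolding H_free_def E'_def by blast+
  ultimately interpret G: C4_kite_free W E'
    using W_cut by (rule C4_kite_freeI)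
  \<comment> \<open>A non-neighbour of \<open>w\<close> cannot lie in \<open>U\<close>. So no vertex
    is universal within \<open>W\<close>, which turns \<open>two_common_nbrs_universal\<close> into
    \<open>unique\<close>.\<close>
  have not_universal: "\<exists>x\<in>W. x \<noteq> w \<and> (w, x) \<notin> E'" if w: "w \<in> W" for w
  proof -
    obtain x where "x \<in> V" "x \<noteq> w" "(w, x) \<notin> E" using w unfolding W_def U_def by auto
    then show ?thesis using U_adj[of x w] w sym UW unfolding E'_def by blast
  qed
  have unique: "(x, y) \<in> E'"
    if "(x, p) \<in> E'" "(x, q) \<in> E'" "(y, p) \<in> E'" "(y, q) \<in> E'" "x \<noteq> y" "p \<noteq> q" for x y p q
    using G.two_common_nbrs_universal[OF that] not_universal by (metis DiffI singletonD)
  interpret P: unique_common_nbr W E'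
  proof
    show "(x, y) \<in> E'\<^sup>*" if "x \<in> W" "y \<in> W" for x y
      using W_cut[of "{}" x y] that unfolding E'_def is_clique_def by simp
    show "2 \<le> card {x. (v, x) \<in> E' \<and> (u, x) \<notin> E' \<and> x \<noteq> u}" (is "_ \<le> card ?X")
      if vu: "(v, u) \<in> E'" for v u
    proof -
      define K where "K = insert v (insert u {x. (v, x) \<in> E' \<and> (u, x) \<in> E'})"
      have "(x, y) \<in> E'" if "(v, x) \<in> E'" "(u, x) \<in> E'" "(v, y) \<in> E'" "(u, y) \<in> E'" "x \<noteq> y" for x y
        using unique[of x v u y] that vu sym irrefl unfolding E'_def by blast
      then have "is_clique W E' K"
        using vu sym unfolding is_clique_def K_def E'_def by blast
      then have KU: "is_clique V E (K \<union> U)" by (rule clique_Un)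
      have v: "v \<in> V" "v \<in> K \<union> U" using vu UW unfolding E'_def K_def by auto
      have fin: "finite (K \<union> U)" using KU finite unfolding is_clique_def by (auto intro: finite_subset)
      have finX: "finite ?X"
        by (rule finite_subset[OF _ finite]) (use UW in \<open>auto simp: E'_def\<close>)
      \<comment> \<open>Outside \<open>?X\<close>, the neighbours of \<open>v\<close> lie in the
        clique \<open>K \<union> U\<close> without \<open>v\<close> itself. As the degree exceeds
        the size of that clique, \<open>?X\<close> has at least two elements.\<close>
      have "{y. (v, y) \<in> E} \<subseteq> (K \<union> U - {v}) \<union> ?X"
        using vu irrefl EV UW unfolding K_def E'_def by blast
      then have "card {y. (v, y) \<in> E} \<le> card ((K \<union> U - {v}) \<union> ?X)"
        using fin finX by (intro card_mono) auto
      also have "\<dots> \<le> card (K \<union> U - {v}) + card ?X" by (rule card_Un_le)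
      also have "card (K \<union> U - {v}) = card (K \<union> U) - 1" using v fin by simp
      finally show ?thesis
        using degree[OF KU v(1)] card_gt_0_iff[of "K \<union> U"] v fin by auto
    qed
  qed (fact G.graph, fact unique)
  \<comment> \<open>Otherwise \<open>V\<close> would be a clique, demanding more neighbours than
    there are vertices.\<close>
  have "W \<noteq> {}"
  proof
    assume "W = {}"
    then have "is_clique V E V" using U_adj UW unfolding is_clique_def by auto
    moreover obtain v where "v \<in> V"
      using assms(2) unfolding connected_graph_def components_def by fastforce
    moreover have "card {y. (v, y) \<in> E} \<le> card V"
      using finite EV by (intro card_mono) auto
    ultimately show False using degree by fastforce
  qed
  then obtain v x where "v \<in> W" "x \<in> W" "x \<noteq> v" using not_universal by blast
  then obtain y where "(v, y) \<in> E'"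
    using P.connected[of v x] by (metis converse_rtranclE)
  then have "graph_iso W E' petersen_V petersen_E"
    by (rule P.petersen_if_P7_free[OF P7])
  then have iso: "graph_iso (V - U) (E \<inter> (V - U) \<times> (V - U)) petersen_V petersen_E"
    by (simp only: W_def E'_def)
  have univ: "(u, x) \<in> E" if "u \<in> U" "x \<in> V - {u}" for u x
    using U_adj that by blast
  have "graph_iso V E (join_K_V (card U) petersen_V) (join_K_E (card U) petersen_V petersen_E)"
    by (rule join_clique_iso[OF assms(1) UW(2) univ iso])
  then show ?thesis by blast
qed

end
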